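(* Any square-free multipermutation cycle set of level $m$ and size $N$ admits an extension of size $2N$ which is square-free and multipermutation of level $m+1$.
   Context: A cycle set is a set $X$ with a binary operation $\cdot$ satisfying $(a\cdot b)\cdot(a\cdot c)=(b\cdot a)\cdot(b\cdot c)$ and such that all left translations $a\mapsto b\cdot a$ are bijective. It is non-degenerate if the squaring map $a\mapsto a\cdot a$ is bijective, and square-free if $a\cdot a=a$ for all $a$ (square-free implies non-degenerate). For a non-degenerate cycle set $(X,\cdot)$, let $a\approx a'$ iff $a\cdot b=a'\cdot b$ for all $b\in X$. It is known that $\cdot$ induces a non-degenerate cycle set structure on $X/\approx$, called the retraction $\operatorname{Ret}(X,\cdot)$. A non-degenerate cycle set is multipermutation of level $n\geqslant0$ if $n$ is the minimal number such that $|\operatorname{Ret}^n(X,\cdot)|=1$. An extension of a cycle set $(X,\cdot)$ by an abelian group $A$ is a cycle set $(Y,\cdot)$ endowed with a left $A$-action $(\alpha,y)\mapsto\alpha y$ and a surjective cycle set homomorphism $p\colon Y\to X$ such that: (1) $A$ acts regularly on each fiber $p^{-1}(x)$ (for all $y,z$ in the same fiber there is a unique $\alpha\in A$ with $\alpha z=y$); (2) $(\alpha y)\cdot z=y\cdot z$ and $y\cdot(\alpha z)=\alpha(y\cdot z)$ for all $\alpha\in A$, $y,z\in Y$. The size of an extension is the cardinality of $Y$, and properties such as square-freeness refer to $Y$. *)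

theory Defs
  imports Main "HOL-Algebra.Group_Action"
begin

unbundle cardinal_syntax

record 'a binary_structure = "'a partial_object" +
  op :: "'a \<Rightarrow> 'a \<Rightarrow> 'a"  (infixl \<open>\<cdot>\<index>\<close> 70)

locale cycle_set =
  fixes X :: "'a binary_structure" (structure)
  assumes closed: "\<lbrakk>a \<in> carrier X; b \<in> carrier X\<rbrakk> \<Longrightarrow> a \<cdot> b \<in> carrier X"
    and cycle: "\<lbrakk>a \<in> carrier X; b \<in> carrier X; c \<in> carrier X\<rbrakk>
                  \<Longrightarrow> (a \<cdot> b) \<cdot> (a \<cdot> c) = (b \<cdot> a) \<cdot> (b \<cdot> c)"
    and bij_left_translation: "b \<in> carrier X \<Longrightarrow> bij_betw (\<lambda>a. b \<cdot> a) (carrier X) (carrier X)"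

locale nondegenerate_cycle_set = cycle_set +
  assumes bij_squaring: "bij_betw (\<lambda>a. a \<cdot> a) (carrier X) (carrier X)"

locale square_free_cycle_set = cycle_set +
  assumes square_free: "a \<in> carrier X \<Longrightarrow> a \<cdot> a = a"

lemma (in square_free_cycle_set) is_nondegenerate: "nondegenerate_cycle_set X"
proof
  have "bij_betw id (carrier X) (carrier X)" by simp
  then show "bij_betw (\<lambda>a. a \<cdot> a) (carrier X) (carrier X)"
    by (rule bij_betw_cong[THEN iffD1, rotated]) (simp add: square_free)
qed

definition cycle_hom :: "'a binary_structure \<Rightarrow> 'b binary_structure \<Rightarrow> ('a \<Rightarrow> 'b) set"
  where "cycle_hom X Y = {h \<in> carrier X \<rightarrow> carrier Y.
    \<forall>a\<in>carrier X. \<forall>b\<in>carrier X. h (a \<cdot>\<^bsub>X\<^esub> b) = h a \<cdot>\<^bsub>Y\<^esub> h b}"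

definition cycle_iso :: "'a binary_structure \<Rightarrow> 'b binary_structure \<Rightarrow> ('a \<Rightarrow> 'b) set"
  where "cycle_iso X Y = {h \<in> cycle_hom X Y. bij_betw h (carrier X) (carrier Y)}"


section \<open>Retraction and multipermutation level\<close>

definition ret_rel :: "'a binary_structure \<Rightarrow> ('a \<times> 'a) set"
  where "ret_rel X = {(a, a'). a \<in> carrier X \<and> a' \<in> carrier X \<and>
    (\<forall>b\<in>carrier X. a \<cdot>\<^bsub>X\<^esub> b = a' \<cdot>\<^bsub>X\<^esub> b)}"

definition Ret :: "'a binary_structure \<Rightarrow> 'a set binary_structure"
  where "Ret X = \<lparr>carrier = carrier X // ret_rel X,
    op = (\<lambda>C D. \<Union>a\<in>C. \<Union>b\<in>D. ret_rel X `` {a \<cdot>\<^bsub>X\<^esub> b})\<rparr>"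

lemma equiv_ret_rel: "equiv (carrier X) (ret_rel X)"
  by (auto simp: equiv_def refl_on_def sym_def trans_def ret_rel_def)

text \<open>
  The multiplication of \<^term>\<open>Ret X\<close> is the one induced from \<open>X\<close>.
\<close>

lemma (in cycle_set) Ret_op_class:
  assumes a: "a \<in> carrier X" and b: "b \<in> carrier X"
  shows "ret_rel X `` {a} \<cdot>\<^bsub>Ret X\<^esub> ret_rel X `` {b} = ret_rel X `` {a \<cdot> b}"
proof -
  have *: "(a \<cdot> b, a' \<cdot> b') \<in> ret_rel X"
    if "(a, a') \<in> ret_rel X" and "(b, b') \<in> ret_rel X" for a a' b b'
  proof -
    have mem: "a \<in> carrier X" "a' \<in> carrier X" "b \<in> carrier X" "b' \<in> carrier X"
      and aa: "\<And>c. c \<in> carrier X \<Longrightarrow> a \<cdot> c = a' \<cdot> c"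
      and bb: "\<And>c. c \<in> carrier X \<Longrightarrow> b \<cdot> c = b' \<cdot> c"
      using that by (auto simp: ret_rel_def)
    have "(a \<cdot> b) \<cdot> d = (a' \<cdot> b') \<cdot> d" if d: "d \<in> carrier X" for d
    proof -
      obtain c where c: "c \<in> carrier X" "d = a \<cdot> c"
        using bij_left_translation[OF mem(1)] d by (auto simp: bij_betw_def)
      have "(a \<cdot> b) \<cdot> d = (b \<cdot> a) \<cdot> (b \<cdot> c)" using cycle mem c by simp
      also have "\<dots> = (b' \<cdot> a) \<cdot> (b' \<cdot> c)" using bb mem c by simp
      also have "\<dots> = (a \<cdot> b') \<cdot> (a \<cdot> c)" using cycle mem c by simp
      also have "\<dots> = (a' \<cdot> b') \<cdot> d" using aa mem c by simp
      finally show ?thesis .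
    qed
    then show ?thesis using mem closed by (simp add: ret_rel_def)
  qed
  have "ret_rel X `` {a' \<cdot> b'} = ret_rel X `` {a \<cdot> b}"
    if "a' \<in> ret_rel X `` {a}" "b' \<in> ret_rel X `` {b}" for a' b'
    using equiv_class_eq[OF equiv_ret_rel *, of a a' b b'] that by auto
  moreover have "a \<in> ret_rel X `` {a}" "b \<in> ret_rel X `` {b}"
    using equiv_class_self[OF equiv_ret_rel] a b by auto
  ultimately have "(\<Union>a'\<in>ret_rel X `` {a}. \<Union>b'\<in>ret_rel X `` {b}. ret_rel X `` {a' \<cdot> b'})
      = ret_rel X `` {a \<cdot> b}"
    by blast
  then show ?thesis by (simp add: Ret_def)
qed

text \<open>
  \<^term>\<open>Ret X\<close> lives on the type of sets over the type of \<open>X\<close>, so \<^term>\<open>Ret\<close> itself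
  cannot be iterated a variable number of times. For that purpose it is transported back to
  the type of \<open>X\<close> along a choice of one representative per class.
\<close>

definition Ret_rep :: "'a binary_structure \<Rightarrow> 'a binary_structure"
  where "Ret_rep X = (let rep = (\<lambda>C. SOME x. x \<in> C) in
    \<lparr>carrier = rep ` carrier (Ret X),
     op = (\<lambda>x y. rep (ret_rel X `` {x} \<cdot>\<^bsub>Ret X\<^esub> ret_rel X `` {y}))\<rparr>)"

lemma (in cycle_set) Ret_rep_iso: "(\<lambda>x. ret_rel X `` {x}) \<in> cycle_iso (Ret_rep X) (Ret X)"
proof -
  define rep where "rep C = (SOME x. x \<in> C)" for C :: "'a set"
  define cl where "cl x = ret_rel X `` {x}" for x
  have rep: "rep C \<in> carrier X \<and> cl (rep C) = C" if C: "C \<in> carrier (Ret X)" for C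
  proof -
    have C': "C \<in> carrier X // ret_rel X" using C by (simp add: Ret_def)
    then obtain x where x: "x \<in> carrier X" "C = ret_rel X `` {x}" by (auto elim: quotientE)
    have "rep C \<in> C" unfolding rep_def
      using equiv_class_self[OF equiv_ret_rel x(1)] x(2) by (metis someI)
    then have r: "(x, rep C) \<in> ret_rel X" using x by simp
    have "rep C \<in> carrier X" using r unfolding ret_rel_def by blast
    moreover have "cl (rep C) = C"
      unfolding cl_def using equiv_class_eq[OF equiv_ret_rel r] x(2) by metis
    ultimately show ?thesis ..
  qed
  have carr: "carrier (Ret_rep X) = rep ` carrier (Ret X)"
    and opr: "x \<cdot>\<^bsub>Ret_rep X\<^esub> y = rep (cl x \<cdot>\<^bsub>Ret X\<^esub> cl y)" for x y
    by (simp_all add: Ret_rep_def Let_def rep_def cl_def)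
  have "cl (x \<cdot>\<^bsub>Ret_rep X\<^esub> y) = cl x \<cdot>\<^bsub>Ret X\<^esub> cl y"
    if "x \<in> carrier (Ret_rep X)" "y \<in> carrier (Ret_rep X)" for x y
  proof -
    have xy: "x \<in> carrier X" "y \<in> carrier X" using that rep by (auto simp: carr)
    have "cl x \<cdot>\<^bsub>Ret X\<^esub> cl y = cl (x \<cdot> y)" unfolding cl_def by (rule Ret_op_class[OF xy])
    moreover have "cl (x \<cdot> y) \<in> carrier (Ret X)"
      unfolding cl_def Ret_def using quotientI[OF closed[OF xy]] by simp
    ultimately show ?thesis using rep by (metis opr)
  qed
  moreover have bij: "bij_betw cl (carrier (Ret_rep X)) (carrier (Ret X))"
    by (rule bij_betwI[where g = rep]) (auto simp: carr rep)
  moreover have "cl \<in> carrier (Ret_rep X) \<rightarrow> carrier (Ret X)"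
    using bij by (rule bij_betw_imp_funcset)
  ultimately have "cl \<in> cycle_iso (Ret_rep X) (Ret X)"
    unfolding cycle_iso_def cycle_hom_def by blast
  then show ?thesis by (simp add: cl_def[abs_def])
qed

definition multipermutation_of_level :: "'a binary_structure \<Rightarrow> nat \<Rightarrow> bool"
  where "multipermutation_of_level X n \<longleftrightarrow> nondegenerate_cycle_set X \<and>
    card (carrier ((Ret_rep ^^ n) X)) = 1 \<and>
    (\<forall>k<n. card (carrier ((Ret_rep ^^ k) X)) \<noteq> 1)"


section \<open>Extensions\<close>

text \<open>
  That \<open>A\<close> acts on every fiber is made explicit in \<open>fiber_closed\<close>.
\<close>

locale cycle_set_extension =
  base: cycle_set X + total: cycle_set Y + comm_group A + group_action A "carrier Y" \<phi>
  for X :: "'x binary_structure" and A :: "'g monoid" and Y :: "'y binary_structure"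
    and \<phi> :: "'g \<Rightarrow> 'y \<Rightarrow> 'y" and p :: "'y \<Rightarrow> 'x" +
  assumes proj_hom: "p \<in> cycle_hom Y X"
    and proj_surj: "p ` carrier Y = carrier X"
    and fiber_closed: "\<lbrakk>\<alpha> \<in> carrier A; y \<in> carrier Y\<rbrakk> \<Longrightarrow> p (\<phi> \<alpha> y) = p y"
    and fiber_regular: "\<lbrakk>y \<in> carrier Y; z \<in> carrier Y; p y = p z\<rbrakk>
                          \<Longrightarrow> \<exists>!\<alpha>. \<alpha> \<in> carrier A \<and> \<phi> \<alpha> z = y"
    and act_left: "\<lbrakk>\<alpha> \<in> carrier A; y \<in> carrier Y; z \<in> carrier Y\<rbrakk>
                     \<Longrightarrow> \<phi> \<alpha> y \<cdot>\<^bsub>Y\<^esub> z = y \<cdot>\<^bsub>Y\<^esub> z"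
    and act_right: "\<lbrakk>\<alpha> \<in> carrier A; y \<in> carrier Y; z \<in> carrier Y\<rbrakk>
                     \<Longrightarrow> y \<cdot>\<^bsub>Y\<^esub> \<phi> \<alpha> z = \<phi> \<alpha> (y \<cdot>\<^bsub>Y\<^esub> z)"

text \<open>
  Sizes are cardinal numbers, with \<open>2N\<close> written \<^term>\<open>ctwo *c N\<close>. For finite
  sets this is the usual counting of elements:
\<close>

lemma card_double_finite:
  assumes "|S| =o N" and "|T| =o ctwo *c N" and "finite S"
  shows "finite T \<and> card T = 2 * card S"
proof -
  have "ctwo *c N =o ctwo *c |S|" by (rule cprod_cong2[OF ordIso_symmetric[OF assms(1)]])
  then have "|T| =o ctwo *c |S|" by (rule ordIso_transitive[OF assms(2)])
  then have "|T| =o |(UNIV :: bool set) \<times> S|"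
    by (simp only: ctwo_def cprod_def Field_card_of)
  then have "\<exists>f. bij_betw f T ((UNIV :: bool set) \<times> S)"
    by (rule card_of_ordIso[THEN iffD2])
  then obtain f where f: "bij_betw f T ((UNIV :: bool set) \<times> S)" ..
  have "finite T" using bij_betw_finite[OF f] assms(3) by simp
  moreover have "card T = 2 * card S"
    using bij_betw_same_card[OF f] by (simp add: card_cartesian_product)
  ultimately show ?thesis ..
qed

end

(* With f x y = 0 if x = y and f x y = 1 otherwise, bijectivity of left translations gives
   f (x . y) (x . z) = f y z, so that the cocycle identity
     f x z + f (x . y) (x . z) = f y z + f (y . x) (y . z)
   just says f x z + f y z = f y z + f x z.
   Distinct elements have distinct rows f x, hence two elements of the extension of X by Z/2
   along f are retract-equivalent iff they lie over the same element of X: the retraction of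
   the extension is X itself. *)

theory Submission
  imports Defs "HOL-Algebra.Elementary_Groups"
begin

section \<open>Retractions and isomorphisms\<close>

text \<open>The choice made by \<open>rep\<close> in \<open>Ret_rep\<close>, read on elements
  instead of classes, so that the carrier of \<open>Ret_rep X\<close> is the image of a map from the
  carrier of \<open>X\<close> to itself.\<close>

definition retract :: "'a binary_structure \<Rightarrow> 'a \<Rightarrow> 'a"
  where "retract X x = (SOME y. y \<in> ret_rel X `` {x})"

context cycle_set
begin

lemma retract_ret_rel:
  assumes "x \<in> carrier X"
  shows "(x, retract X x) \<in> ret_rel X"
proof -
  have "x \<in> ret_rel X `` {x}"
    using equiv_class_self[OF equiv_ret_rel assms] .
  then have "retract X x \<in> ret_rel X `` {x}"
    unfolding retract_def by (rule someI)
  then show ?thesis by simp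
qed

lemma retract_closed: "x \<in> carrier X \<Longrightarrow> retract X x \<in> carrier X"
  using retract_ret_rel unfolding ret_rel_def by blast

lemma retract_eq_iff:
  assumes "x \<in> carrier X" "y \<in> carrier X"
  shows "retract X x = retract X y \<longleftrightarrow> (x, y) \<in> ret_rel X"
proof
  assume "retract X x = retract X y"
  then show "(x, y) \<in> ret_rel X"
    using retract_ret_rel[OF assms(1)] retract_ret_rel[OF assms(2)]
    by (auto simp: ret_rel_def)
next
  assume "(x, y) \<in> ret_rel X"
  then show "retract X x = retract X y"
    unfolding retract_def by (simp add: equiv_class_eq[OF equiv_ret_rel])
qed

lemma carrier_Ret_rep: "carrier (Ret_rep X) = retract X ` carrier X"
proof -
  have "carrier X // ret_rel X = (\<lambda>x. ret_rel X `` {x}) ` carrier X"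
    by (auto simp: quotient_def)
  then show ?thesis
    by (simp add: Ret_rep_def Ret_def Let_def image_image retract_def)
qed

text \<open>The operation of \<open>Ret_rep X\<close> passes to classes before choosing, hence the
  formula covers arbitrary elements of \<open>X\<close>, not just representatives.\<close>

lemma op_Ret_rep:
  "\<lbrakk>x \<in> carrier X; y \<in> carrier X\<rbrakk> \<Longrightarrow> x \<cdot>\<^bsub>Ret_rep X\<^esub> y = retract X (x \<cdot> y)"
  by (simp add: Ret_rep_def Let_def retract_def Ret_op_class)

lemma retract_op:
  assumes "x \<in> carrier X" "y \<in> carrier X"
  shows "retract X x \<cdot>\<^bsub>Ret_rep X\<^esub> retract X y = retract X (x \<cdot> y)"
proof -
  have cl: "ret_rel X `` {retract X z} = ret_rel X `` {z}" if "z \<in> carrier X" for z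
    using equiv_class_eq[OF equiv_ret_rel retract_ret_rel[OF that]] by simp
  show ?thesis
    using assms by (simp add: Ret_rep_def Let_def cl Ret_op_class retract_def[of _ "x \<cdot> y"])
qed

text \<open>A homomorphism theorem: \<open>q\<close> is constant on classes, so it agrees on
  \<open>x\<close> and \<open>retract X x\<close>; restricted to representatives it becomes
  injective and keeps its image.\<close>

lemma Ret_rep_iso_of_kernel:
  assumes hom: "q \<in> cycle_hom X Z"
    and surj: "q ` carrier X = carrier Z"
    and ker: "\<And>x y. \<lbrakk>x \<in> carrier X; y \<in> carrier X\<rbrakk> \<Longrightarrow> q x = q y \<longleftrightarrow> (x, y) \<in> ret_rel X"
  shows "q \<in> cycle_iso (Ret_rep X) Z"
proof -
  have q_retract: "q (retract X x) = q x" if "x \<in> carrier X" for x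
    using that ker[of x "retract X x"] by (simp add: retract_closed retract_ret_rel)
  have "inj_on q (carrier (Ret_rep X))"
    by (rule inj_onI) (auto simp: carrier_Ret_rep q_retract ker retract_eq_iff)
  moreover have "q ` carrier (Ret_rep X) = carrier Z"
    using surj by (force simp: carrier_Ret_rep image_image q_retract)
  moreover have "q (x \<cdot>\<^bsub>Ret_rep X\<^esub> y) = q x \<cdot>\<^bsub>Z\<^esub> q y"
    if "x \<in> carrier (Ret_rep X)" "y \<in> carrier (Ret_rep X)" for x y
    using that hom
    by (auto simp: carrier_Ret_rep op_Ret_rep retract_closed closed q_retract cycle_hom_def)
  ultimately show ?thesis
    by (auto simp: cycle_iso_def cycle_hom_def bij_betw_def)
qed

lemma left_cancel:
  "\<lbrakk>x \<in> carrier X; y \<in> carrier X; z \<in> carrier X\<rbrakk> \<Longrightarrow> x \<cdot> y = x \<cdot> z \<longleftrightarrow> y = z"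
  using bij_left_translation[of x] by (auto simp: bij_betw_def inj_on_def)

end

text \<open>Square-freeness enters through the injectivity of the induced left translations: if
  \<open>b \<cdot> a\<close> and \<open>b \<cdot> a'\<close> act equally, then evaluating the cycle identity at
  \<open>b\<close> itself yields \<open>a \<cdot> b = a' \<cdot> b\<close>, which can then be cancelled.\<close>

lemma (in square_free_cycle_set) square_free_Ret_rep: "square_free_cycle_set (Ret_rep X)"
proof
  fix a b c
  assume "a \<in> carrier (Ret_rep X)" "b \<in> carrier (Ret_rep X)"
  then show "a \<cdot>\<^bsub>Ret_rep X\<^esub> b \<in> carrier (Ret_rep X)"
    by (auto simp: carrier_Ret_rep retract_op closed)
  assume "c \<in> carrier (Ret_rep X)"
  with \<open>a \<in> _\<close> \<open>b \<in> _\<close>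
  show "(a \<cdot>\<^bsub>Ret_rep X\<^esub> b) \<cdot>\<^bsub>Ret_rep X\<^esub> (a \<cdot>\<^bsub>Ret_rep X\<^esub> c)
      = (b \<cdot>\<^bsub>Ret_rep X\<^esub> a) \<cdot>\<^bsub>Ret_rep X\<^esub> (b \<cdot>\<^bsub>Ret_rep X\<^esub> c)"
    by (auto simp: carrier_Ret_rep retract_op closed cycle)
next
  fix b
  assume "b \<in> carrier (Ret_rep X)"
  then obtain d where d: "d \<in> carrier X" "b = retract X d"
    by (auto simp: carrier_Ret_rep)
  have cancel: "(x, y) \<in> ret_rel X"
    if xy: "x \<in> carrier X" "y \<in> carrier X" and rel: "(d \<cdot> x, d \<cdot> y) \<in> ret_rel X" for x y
  proof -
    have eq: "(x \<cdot> d) \<cdot> (x \<cdot> c) = (y \<cdot> d) \<cdot> (y \<cdot> c)" if "c \<in> carrier X" for c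
      using rel that xy d(1) closed cycle[of d x c] cycle[of d y c] by (simp add: ret_rel_def)
    have "x \<cdot> d = y \<cdot> d"
      using eq[OF d(1)] xy d(1) by (simp add: square_free closed)
    then have "x \<cdot> c = y \<cdot> c" if "c \<in> carrier X" for c
      using eq[OF that] that xy d(1) by (simp add: left_cancel closed)
    then show ?thesis using xy by (simp add: ret_rel_def)
  qed
  have "inj_on (\<lambda>a. b \<cdot>\<^bsub>Ret_rep X\<^esub> a) (carrier (Ret_rep X))"
    using d by (auto intro!: inj_onI cancel simp: carrier_Ret_rep retract_op closed retract_eq_iff)
  moreover have "(\<lambda>a. b \<cdot>\<^bsub>Ret_rep X\<^esub> a) ` carrier (Ret_rep X) = carrier (Ret_rep X)"
  proof -
    have "(\<lambda>a. b \<cdot>\<^bsub>Ret_rep X\<^esub> a) ` carrier (Ret_rep X)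
        = retract X ` (\<lambda>a. d \<cdot> a) ` carrier X"
      using d by (simp add: carrier_Ret_rep image_image retract_op cong: image_cong_simp)
    then show ?thesis
      using bij_left_translation[OF d(1)] by (simp add: bij_betw_def carrier_Ret_rep)
  qed
  ultimately show "bij_betw (\<lambda>a. b \<cdot>\<^bsub>Ret_rep X\<^esub> a) (carrier (Ret_rep X)) (carrier (Ret_rep X))"
    by (simp add: bij_betw_def)
next
  fix a
  assume "a \<in> carrier (Ret_rep X)"
  then show "a \<cdot>\<^bsub>Ret_rep X\<^esub> a = a"
    by (auto simp: carrier_Ret_rep retract_op square_free)
qed

section \<open>Invariance of iterated retractions under isomorphism\<close>

lemma cycle_iso_ret_rel:
  assumes "h \<in> cycle_iso X Z" and "cycle_set X" and "cycle_set Z"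
    and xy: "x \<in> carrier X" "y \<in> carrier X"
  shows "(h x, h y) \<in> ret_rel Z \<longleftrightarrow> (x, y) \<in> ret_rel X"
proof -
  have h: "inj_on h (carrier X)" "h ` carrier X = carrier Z"
    and hom: "\<And>a b. \<lbrakk>a \<in> carrier X; b \<in> carrier X\<rbrakk> \<Longrightarrow> h a \<cdot>\<^bsub>Z\<^esub> h b = h (a \<cdot>\<^bsub>X\<^esub> b)"
    using assms(1) by (auto simp: cycle_iso_def cycle_hom_def bij_betw_def)
  have "(h x, h y) \<in> ret_rel Z \<longleftrightarrow> (\<forall>c\<in>carrier X. h (x \<cdot>\<^bsub>X\<^esub> c) = h (y \<cdot>\<^bsub>X\<^esub> c))"
    using xy by (simp add: ret_rel_def hom flip: h(2))
  also have "\<dots> \<longleftrightarrow> (x, y) \<in> ret_rel X"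
    using xy by (simp add: ret_rel_def inj_on_eq_iff[OF h(1)] cycle_set.closed[OF assms(2)])
  finally show ?thesis .
qed

text \<open>An isomorphism need not send chosen representatives to chosen representatives; composing
  with \<open>retract Z\<close> corrects this, and the kernel of the composite is
  \<open>ret_rel X\<close>.\<close>

lemma cycle_iso_Ret_rep:
  assumes iso: "h \<in> cycle_iso X Z" and X: "cycle_set X" and Z: "cycle_set Z"
  shows "retract Z \<circ> h \<in> cycle_iso (Ret_rep X) (Ret_rep Z)"
proof (rule cycle_set.Ret_rep_iso_of_kernel[OF X])
  have h: "h ` carrier X = carrier Z"
    and hom: "\<And>a b. \<lbrakk>a \<in> carrier X; b \<in> carrier X\<rbrakk> \<Longrightarrow> h (a \<cdot>\<^bsub>X\<^esub> b) = h a \<cdot>\<^bsub>Z\<^esub> h b"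
    using iso by (auto simp: cycle_iso_def cycle_hom_def bij_betw_def)
  have h_mem: "h a \<in> carrier Z" if "a \<in> carrier X" for a
    using that h by blast
  show "retract Z \<circ> h \<in> cycle_hom X (Ret_rep Z)"
    by (auto simp: cycle_hom_def cycle_set.carrier_Ret_rep[OF Z] cycle_set.retract_op[OF Z]
        hom h_mem)
  show "(retract Z \<circ> h) ` carrier X = carrier (Ret_rep Z)"
    by (simp add: cycle_set.carrier_Ret_rep[OF Z] image_comp[symmetric] h del: o_apply)
  show "(retract Z \<circ> h) x = (retract Z \<circ> h) y \<longleftrightarrow> (x, y) \<in> ret_rel X"
    if "x \<in> carrier X" "y \<in> carrier X" for x y
    using that
    by (simp add: cycle_set.retract_eq_iff[OF Z] h_mem cycle_iso_ret_rel[OF iso X Z])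
qed

text \<open>Square-freeness passes to retractions, so every stage remains a cycle set. The induction
  peels off the innermost retraction, which is why \<open>X\<close>, \<open>Z\<close> and
  \<open>h\<close> vary.\<close>

lemma card_Ret_rep_funpow_cong:
  assumes "h \<in> cycle_iso X Z" and "square_free_cycle_set X" and "square_free_cycle_set Z"
  shows "card (carrier ((Ret_rep ^^ k) X)) = card (carrier ((Ret_rep ^^ k) Z))"
  using assms
proof (induction k arbitrary: X Z h)
  case 0
  then show ?case by (auto simp: cycle_iso_def dest: bij_betw_same_card)
next
  case (Suc k)
  have "cycle_set X" "cycle_set Z"
    using Suc.prems by (simp_all add: square_free_cycle_set.axioms(1))
  then show ?case
    using Suc.IH[OF cycle_iso_Ret_rep[OF Suc.prems(1)]] Suc.prems
    by (simp add: square_free_cycle_set.square_free_Ret_rep funpow_Suc_right del: funpow.simps)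
qed


section \<open>Extensions defined by cocycles\<close>

text \<open>The product is invariant under translation in its first argument and equivariant in its
  second, as the extension axioms demand; \<open>f\<close> is the remaining freedom.\<close>

definition cocycle_extension ::
    "'a binary_structure \<Rightarrow> ('g, 'r) monoid_scheme \<Rightarrow> ('a \<Rightarrow> 'a \<Rightarrow> 'g) \<Rightarrow> ('g \<times> 'a) binary_structure"
  where "cocycle_extension X A f = \<lparr>carrier = carrier A \<times> carrier X,
    op = (\<lambda>(\<alpha>, x) (\<beta>, y). (f x y \<otimes>\<^bsub>A\<^esub> \<beta>, x \<cdot>\<^bsub>X\<^esub> y))\<rparr>"

text \<open>The action is restricted to the carrier because elements of \<^const>\<open>BijGroup\<close> are
  extensional functions.\<close>

definition translation_action ::
    "'a binary_structure \<Rightarrow> ('g, 'r) monoid_scheme \<Rightarrow> 'g \<Rightarrow> 'g \<times> 'a \<Rightarrow> 'g \<times> 'a"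
  where "translation_action X A \<alpha> =
    (\<lambda>y \<in> carrier A \<times> carrier X. (\<alpha> \<otimes>\<^bsub>A\<^esub> fst y, snd y))"

lemma (in comm_group) group_action_translation:
  "group_action G (carrier G \<times> carrier X) (translation_action X G)"
proof -
  let ?E = "carrier G \<times> carrier X"
  have Bij: "translation_action X G a \<in> Bij ?E" if a: "a \<in> carrier G" for a
  proof -
    have "bij_betw (translation_action X G a) ?E ?E"
      by (rule bij_betwI[where g = "translation_action X G (inv a)"])
        (auto simp: translation_action_def a m_assoc[symmetric] l_inv r_inv)
    then show ?thesis by (simp add: Bij_def translation_action_def)
  qed
  have "translation_action X G (a \<otimes> b)
      = translation_action X G a \<otimes>\<^bsub>BijGroup ?E\<^esub> translation_action X G b"
    if "a \<in> carrier G" "b \<in> carrier G" for a b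
  proof -
    have "translation_action X G (a \<otimes> b)
        = compose ?E (translation_action X G a) (translation_action X G b)"
      using that by (auto simp: compose_def translation_action_def fun_eq_iff m_assoc)
    then show ?thesis using that Bij by (simp add: BijGroup_def)
  qed
  then have "translation_action X G \<in> hom G (BijGroup ?E)"
    using Bij by (auto simp: hom_def BijGroup_def)
  then show ?thesis
    by (simp add: group_action_def group_hom_def group_hom_axioms_def group_BijGroup)
qed

text \<open>The equation \<open>cocycle\<close> is the group coordinate of the cycle identity for
  (\<alpha>, x), (\<beta>, y), (\<gamma>, z), with \<gamma> cancelled.\<close>

locale cycle_set_cocycle = cycle_set X + A: comm_group A
  for X :: "'a binary_structure" (structure) and A :: "('g, 'r) monoid_scheme" +
  fixes f :: "'a \<Rightarrow> 'a \<Rightarrow> 'g"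
  assumes cocycle_closed: "\<lbrakk>x \<in> carrier X; y \<in> carrier X\<rbrakk> \<Longrightarrow> f x y \<in> carrier A"
    and cocycle: "\<lbrakk>x \<in> carrier X; y \<in> carrier X; z \<in> carrier X\<rbrakk> \<Longrightarrow>
      f (x \<cdot> y) (x \<cdot> z) \<otimes>\<^bsub>A\<^esub> f x z = f (y \<cdot> x) (y \<cdot> z) \<otimes>\<^bsub>A\<^esub> f y z"
begin

abbreviation "Y \<equiv> cocycle_extension X A f"

lemma carrier_Y: "carrier Y = carrier A \<times> carrier X"
  by (simp add: cocycle_extension_def)

lemma op_Y: "(\<alpha>, x) \<cdot>\<^bsub>Y\<^esub> (\<beta>, y) = (f x y \<otimes>\<^bsub>A\<^esub> \<beta>, x \<cdot> y)"
  by (simp add: cocycle_extension_def)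

lemma cycle_set_Y: "cycle_set Y"
proof
  fix a b c
  assume "a \<in> carrier Y" "b \<in> carrier Y"
  then show "a \<cdot>\<^bsub>Y\<^esub> b \<in> carrier Y"
    by (auto simp: carrier_Y op_Y cocycle_closed closed)
  assume "c \<in> carrier Y"
  with \<open>a \<in> _\<close> \<open>b \<in> _\<close>
  show "(a \<cdot>\<^bsub>Y\<^esub> b) \<cdot>\<^bsub>Y\<^esub> (a \<cdot>\<^bsub>Y\<^esub> c) = (b \<cdot>\<^bsub>Y\<^esub> a) \<cdot>\<^bsub>Y\<^esub> (b \<cdot>\<^bsub>Y\<^esub> c)"
    by (auto simp: carrier_Y op_Y cocycle_closed closed cycle cocycle A.m_assoc[symmetric])
next
  fix b
  assume "b \<in> carrier Y"
  then obtain \<beta> x where b: "b = (\<beta>, x)" "x \<in> carrier X" by (auto simp: carrier_Y)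
  have surj: "\<exists>y\<in>carrier X. x \<cdot> y = z" if "z \<in> carrier X" for z
    using bij_left_translation[OF b(2)] that by (auto simp: bij_betw_def image_iff dest: equalityD2[THEN subsetD])
  have "inj_on (\<lambda>a. b \<cdot>\<^bsub>Y\<^esub> a) (carrier Y)"
    using b by (auto intro!: inj_onI simp: carrier_Y op_Y left_cancel cocycle_closed)
  moreover have "w \<in> (\<lambda>a. b \<cdot>\<^bsub>Y\<^esub> a) ` carrier Y" if w: "w \<in> carrier Y" for w
  proof -
    obtain \<gamma> y where y: "w = (\<gamma>, x \<cdot> y)" "\<gamma> \<in> carrier A" "y \<in> carrier X"
      using w surj by (fastforce simp: carrier_Y)
    \<comment> \<open>The preimage is found coordinatewise: first \<open>y\<close> by dividing by
      \<open>x\<close> in \<open>X\<close>, then \<open>f x y\<close> is cancelled in the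
      group.\<close>
    have "w = b \<cdot>\<^bsub>Y\<^esub> (inv\<^bsub>A\<^esub> f x y \<otimes>\<^bsub>A\<^esub> \<gamma>, y)"
      using b y by (simp add: op_Y cocycle_closed A.m_assoc[symmetric] A.r_inv)
    then show ?thesis
      using b y by (auto simp: carrier_Y cocycle_closed)
  qed
  ultimately show "bij_betw (\<lambda>a. b \<cdot>\<^bsub>Y\<^esub> a) (carrier Y) (carrier Y)"
    using b by (auto simp: bij_betw_def carrier_Y op_Y cocycle_closed closed)
qed

lemma snd_hom: "snd \<in> cycle_hom Y X"
  by (auto simp: cycle_hom_def carrier_Y op_Y)

lemma snd_surj: "snd ` carrier Y = carrier X"
  using A.one_closed by (auto simp: carrier_Y image_iff intro!: bexI[of _ "(\<one>\<^bsub>A\<^esub>, _)"])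

text \<open>Testing against (\<beta>, z) compares \<open>x\<close> and \<open>y\<close> in
  \<open>X\<close> and, after cancelling \<beta>, the rows of \<open>f\<close>. The retraction thus
  depends on how far these rows separate points.\<close>

lemma ret_rel_Y:
  assumes "(\<alpha>, x) \<in> carrier Y" "(\<beta>, y) \<in> carrier Y"
  shows "((\<alpha>, x), (\<beta>, y)) \<in> ret_rel Y \<longleftrightarrow>
    (x, y) \<in> ret_rel X \<and> (\<forall>z\<in>carrier X. f x z = f y z)"
  using assms A.one_closed by (auto simp: ret_rel_def carrier_Y op_Y cocycle_closed)

end

lemma (in cycle_set_cocycle) square_free_Y:
  assumes "\<And>x. x \<in> carrier X \<Longrightarrow> x \<cdot> x = x" and "\<And>x. x \<in> carrier X \<Longrightarrow> f x x = \<one>\<^bsub>A\<^esub>"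
  shows "square_free_cycle_set Y"
proof -
  interpret Y: cycle_set Y by (rule cycle_set_Y)
  show ?thesis by unfold_locales (auto simp: carrier_Y op_Y assms)
qed

text \<open>Stated outside the locale because \<open>cycle_set_extension\<close> expects a plain
  \<open>monoid\<close>, while \<open>cycle_set_cocycle\<close> admits any record extension.\<close>

lemma cocycle_extension_is_extension:
  fixes A :: "'g monoid"
  assumes "cycle_set_cocycle X A f"
  shows "cycle_set_extension X A (cocycle_extension X A f) (translation_action X A) snd"
proof -
  interpret cycle_set_cocycle X A f by fact
  interpret Y: cycle_set Y by (rule cycle_set_Y)
  interpret group_action A "carrier Y" "translation_action X A"
    using A.group_action_translation by (simp add: carrier_Y)
  show ?thesis
  proof unfold_locales
    show "snd \<in> cycle_hom Y X" by (rule snd_hom)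
    show "snd ` carrier Y = carrier X" by (rule snd_surj)
  next
    fix y z
    assume yz: "y \<in> carrier Y" "z \<in> carrier Y" "snd y = snd z"
    show "\<exists>!\<alpha>. \<alpha> \<in> carrier A \<and> translation_action X A \<alpha> z = y"
    proof
      \<comment> \<open>Within a fiber only the group coordinates differ, and their quotient is the
        required translation.\<close>
      show "fst y \<otimes>\<^bsub>A\<^esub> inv\<^bsub>A\<^esub> fst z \<in> carrier A \<and>
          translation_action X A (fst y \<otimes>\<^bsub>A\<^esub> inv\<^bsub>A\<^esub> fst z) z = y"
        using yz by (auto simp: translation_action_def carrier_Y A.m_assoc)
    next
      fix \<alpha>
      assume "\<alpha> \<in> carrier A \<and> translation_action X A \<alpha> z = y"
      then show "\<alpha> = fst y \<otimes>\<^bsub>A\<^esub> inv\<^bsub>A\<^esub> fst z"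
        using yz by (auto simp: translation_action_def carrier_Y A.m_assoc)
    qed
  \<comment> \<open>Commutativity of \<open>A\<close> gives \<open>act_right\<close>:
    \<open>A.m_lcomm\<close> moves \<alpha> past the value of \<open>f\<close>.\<close>
  qed (auto simp: translation_action_def carrier_Y op_Y cocycle_closed closed A.m_lcomm)
qed

section \<open>The discrete cocycle with values in Z/2 and the level count\<close>

lemma carrier_integer_mod_group_2: "carrier (integer_mod_group 2) = {0, 1}"
  by (auto simp: carrier_integer_mod_group)

lemma (in cycle_set) discrete_cocycle:
  "cycle_set_cocycle X (integer_mod_group 2) (\<lambda>x y. of_bool (x \<noteq> y))"
proof -
  interpret A: comm_group "integer_mod_group 2" by (rule abelian_integer_mod_group)
  show ?thesis
    by unfold_locales
      (auto simp: carrier_integer_mod_group_2 left_cancel mult_integer_mod_group)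
qed

theorem theorem10p6:
  fixes X :: "'a binary_structure" and N :: "'n rel" and m :: nat
  assumes "square_free_cycle_set X"
    and "multipermutation_of_level X m"
    and "|carrier X| =o N"
  shows "\<exists>(A :: int monoid) (Y :: (int \<times> 'a) binary_structure) \<phi> p.
    cycle_set_extension X A Y \<phi> p \<and>
    |carrier Y| =o ctwo *c N \<and>
    square_free_cycle_set Y \<and>
    multipermutation_of_level Y (m + 1)"
proof -
  interpret square_free_cycle_set X by fact
  define A where "A = integer_mod_group 2"
  define f :: "'a \<Rightarrow> 'a \<Rightarrow> int" where "f = (\<lambda>x y. of_bool (x \<noteq> y))"
  interpret cycle_set_cocycle X A f
    unfolding A_def f_def by (rule discrete_cocycle)
  have A: "carrier A = {0, 1}" by (simp add: A_def carrier_integer_mod_group_2)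
  have Y: "square_free_cycle_set Y"
    by (rule square_free_Y) (simp_all add: square_free f_def A_def)
  interpret Y: square_free_cycle_set Y by (rule Y)
  have "snd u = snd v \<longleftrightarrow> (u, v) \<in> ret_rel Y" if "u \<in> carrier Y" "v \<in> carrier Y" for u v
  proof -
    have "snd v \<in> carrier X"
      using \<open>v \<in> carrier Y\<close> by (simp add: carrier_Y mem_Times_iff)
    \<comment> \<open>At \<open>z = snd v\<close> the right-hand row has its zero, so the left-hand
      one vanishes there too.\<close>
    then have "snd u = snd v"
      if "\<forall>z\<in>carrier X. f (snd u) z = f (snd v) z"
      using that[rule_format, of "snd v"] by (simp add: f_def)
    then show ?thesis
      using that ret_rel_Y[of "fst u" "snd u" "fst v" "snd v"]
      by (auto simp: carrier_Y ret_rel_def[of X])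
  qed
  then have iso: "snd \<in> cycle_iso (Ret_rep Y) X"
    by (rule Y.Ret_rep_iso_of_kernel[OF snd_hom snd_surj])
  \<comment> \<open>One retraction turns \<open>Y\<close> into a copy of \<open>X\<close>, so the
    counts for \<open>Y\<close> are those for \<open>X\<close> shifted by one.\<close>
  have card_Suc: "card (carrier ((Ret_rep ^^ Suc k) Y)) = card (carrier ((Ret_rep ^^ k) X))" for k
    using card_Ret_rep_funpow_cong[OF iso Y.square_free_Ret_rep assms(1)]
    by (simp add: funpow_Suc_right del: funpow.simps)
  \<comment> \<open>Minimality at stage 0 is not covered by the shift. It follows by parity, also
    for infinite \<open>X\<close>, where \<open>card\<close> is 0.\<close>
  have "card (carrier Y) \<noteq> 1"
  proof -
    have "card (carrier Y) = 2 * card (carrier X)"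
      by (simp add: carrier_Y A card_cartesian_product)
    then show ?thesis by presburger
  qed
  then have "card (carrier ((Ret_rep ^^ k) Y)) \<noteq> 1" if "k < m + 1" for k
    using that assms(2) card_Suc by (cases k) (auto simp: multipermutation_of_level_def
        simp del: funpow.simps(2))
  then have "multipermutation_of_level Y (m + 1)"
    using assms(2) card_Suc[of m] Y.is_nondegenerate
    by (simp add: multipermutation_of_level_def del: funpow.simps)
  moreover have "|carrier Y| =o ctwo *c N"
  proof -
    \<comment> \<open>\<open>ctwo\<close> is the cardinal of the type \<open>bool\<close>, hence the
      matching with {0, 1} by \<open>of_bool\<close>.\<close>
    have "bij_betw of_bool (UNIV :: bool set) (carrier A)"
      by (auto simp: A bij_betw_def inj_on_def UNIV_bool)
    then have "|carrier A| =o ctwo"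
      unfolding ctwo_def using card_of_ordIsoI ordIso_symmetric by blast
    then have "|carrier A| *c |carrier X| =o ctwo *c N"
      using assms(3) by (rule cprod_cong)
    then show ?thesis by (simp add: cprod_def Field_card_of carrier_Y)
  qed
  moreover have "cycle_set_extension X A Y (translation_action X A) snd"
    by (rule cocycle_extension_is_extension) unfold_locales
  ultimately show ?thesis using Y by blast
qed

end
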